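(* For any graft $(G,T)$, the binary relation $\sim_{(G,T)}$ on $V(G)$ is an equivalence relation on $V(G)$.
   Context: Graphs are finite and undirected; $V(G)$ and $E(G)$ denote the vertex and edge sets of $G$. For $v\in V(G)$, $\delta_G(v)$ is the set of edges joining $v$ and $V(G)\setminus\{v\}$. $A\triangle B$ denotes the symmetric difference $(A\setminus B)\cup(B\setminus A)$. Graft: a pair $(G,T)$ of a graph $G$ and a set $T\subseteq V(G)$ such that each connected component of $G$ contains an even number of vertices from $T$. A join of $(G,T)$ is a set $F\subseteq E(G)$ such that $|\delta_G(v)\cap F|$ is odd for each $v\in T$ and even for each $v\in V(G)\setminus T$ (every graft has a join). A minimum join is a join with the minimum number of edges, and $\nu(G,T)$ denotes the number of edges of a minimum join of $(G,T)$. An edge $e\in E(G)$ is allowed in $(G,T)$ if some minimum join of $(G,T)$ contains $e$. A path is a connected graph in which every vertex has degree at most two and at least one vertex has degree less than two (a single vertex is a path). Vertices $u,v\in V(G)$ are factor-connected in $(G,T)$ if there is a path between $u$ and $v$ in $G$ all of whose edges are allowed. Definition of the relation: for $u,v\in V(G)$, $u\sim_{(G,T)}v$ if either $u=v$, or $u$ and $v$ are distinct factor-connected vertices with $\nu(G,T\triangle\{u,v\})=\nu(G,T)$. *)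

theory Defs
  imports Main
begin

text \<open>Undirected graphs, with parallel edges and loops admitted: each edge has a set of
  one (for a loop) or two ends.\<close>

record ('v, 'e) graph =
  verts :: "'v set"
  edges :: "'e set"
  ends :: "'e \<Rightarrow> 'v set"

definition finite_graph :: "('v, 'e) graph \<Rightarrow> bool" where
  "finite_graph G \<longleftrightarrow> finite (verts G) \<and> finite (edges G) \<and>
     (\<forall>e\<in>edges G. \<exists>u\<in>verts G. \<exists>v\<in>verts G. ends G e = {u, v})"

definition subgraph :: "('v, 'e) graph \<Rightarrow> ('v, 'e) graph \<Rightarrow> bool" where
  "subgraph H G \<longleftrightarrow> finite_graph H \<and> verts H \<subseteq> verts G \<and> edges H \<subseteq> edges G \<and>
     (\<forall>e\<in>edges H. ends H e = ends G e)"

definition adj_rel :: "('v, 'e) graph \<Rightarrow> ('v \<times> 'v) set" where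
  "adj_rel G = {(u, v). \<exists>e\<in>edges G. ends G e = {u, v}}"

definition connected_graph :: "('v, 'e) graph \<Rightarrow> bool" where
  "connected_graph G \<longleftrightarrow> verts G \<noteq> {} \<and> (\<forall>u\<in>verts G. \<forall>v\<in>verts G. (u, v) \<in> (adj_rel G)\<^sup>*)"

definition connected_component :: "('v, 'e) graph \<Rightarrow> ('v, 'e) graph \<Rightarrow> bool" where
  "connected_component C G \<longleftrightarrow> subgraph C G \<and> connected_graph C \<and>
     (\<forall>H. subgraph H G \<and> connected_graph H \<and> subgraph C H \<longrightarrow> subgraph H C)"

definition star :: "('v, 'e) graph \<Rightarrow> 'v \<Rightarrow> 'e set" where
  "star G v = {e \<in> edges G. \<exists>w\<in>verts G - {v}. ends G e = {v, w}}"

text \<open>A loop contributes two to the degree of its end.\<close>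

definition degree :: "('v, 'e) graph \<Rightarrow> 'v \<Rightarrow> nat" where
  "degree G v = card {e \<in> edges G. v \<in> ends G e} + card {e \<in> edges G. ends G e = {v}}"

definition is_path :: "('v, 'e) graph \<Rightarrow> bool" where
  "is_path P \<longleftrightarrow> finite_graph P \<and> connected_graph P \<and> (\<forall>x\<in>verts P. degree P x \<le> 2) \<and>
     (\<exists>x\<in>verts P. degree P x < 2)"

text \<open>The ends of a path are its vertices of degree less than two; in a path with a single
  vertex both ends coincide.\<close>

definition path_between :: "('v, 'e) graph \<Rightarrow> 'v \<Rightarrow> 'v \<Rightarrow> bool" where
  "path_between P u v \<longleftrightarrow> is_path P \<and> {x \<in> verts P. degree P x < 2} = {u, v}"

definition graft :: "('v, 'e) graph \<Rightarrow> 'v set \<Rightarrow> bool" where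
  "graft G T \<longleftrightarrow> finite_graph G \<and> T \<subseteq> verts G \<and>
     (\<forall>C. connected_component C G \<longrightarrow> even (card (verts C \<inter> T)))"

definition join :: "('v, 'e) graph \<Rightarrow> 'v set \<Rightarrow> 'e set \<Rightarrow> bool" where
  "join G T F \<longleftrightarrow> F \<subseteq> edges G \<and>
     (\<forall>v\<in>T. odd (card (star G v \<inter> F))) \<and>
     (\<forall>v\<in>verts G - T. even (card (star G v \<inter> F)))"

definition minimum_join :: "('v, 'e) graph \<Rightarrow> 'v set \<Rightarrow> 'e set \<Rightarrow> bool" where
  "minimum_join G T F \<longleftrightarrow> join G T F \<and> (\<forall>F'. join G T F' \<longrightarrow> card F \<le> card F')"

text \<open>Meaningful only if a join exists, in particular if (G, T) is a graft.\<close>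

definition nu :: "('v, 'e) graph \<Rightarrow> 'v set \<Rightarrow> nat" where
  "nu G T = (THE n. \<exists>F. minimum_join G T F \<and> card F = n)"

definition allowed :: "('v, 'e) graph \<Rightarrow> 'v set \<Rightarrow> 'e \<Rightarrow> bool" where
  "allowed G T e \<longleftrightarrow> e \<in> edges G \<and> (\<exists>F. minimum_join G T F \<and> e \<in> F)"

definition factor_connected :: "('v, 'e) graph \<Rightarrow> 'v set \<Rightarrow> 'v \<Rightarrow> 'v \<Rightarrow> bool" where
  "factor_connected G T u v \<longleftrightarrow>
     (\<exists>P. subgraph P G \<and> path_between P u v \<and> (\<forall>e\<in>edges P. allowed G T e))"

text \<open>If u and v are distinct and factor-connected, they lie in one connected component,
  so (G, sym_diff T {u, v}) is again a graft and its nu is meaningful.\<close>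

definition graft_rel :: "('v, 'e) graph \<Rightarrow> 'v set \<Rightarrow> ('v \<times> 'v) set" where
  "graft_rel G T = {(u, v). u \<in> verts G \<and> v \<in> verts G \<and>
     (u = v \<or> u \<noteq> v \<and> factor_connected G T u v \<and> nu G (sym_diff T {u, v}) = nu G T)}"

end

theory Submission
  imports Defs
begin

text \<open>Put h S = nu (G, sym_diff T S) - nu (G, T) and let dst x y be h at {x, y}, which is - 1 on
  allowed edges. Exchanging a path inside the symmetric difference of two minimum joins shows that
  h satisfies the exchange axiom of valuated delta-matroids, and toggling a single edge changes h by
  at most 1. These properties alone imply that dst is nonpositive on each factor-connected class C
  and that, seen from any v in C, no allowed edge of C has both ends at distance 0. Applying the
  exchange axiom to four vertices v, w, x, y with dst v w = 0 and xy an allowed edge, it follows that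
  dst w - dst v is constant on C, hence zero; this is transitivity. If there is no join at all, then
  no edge is allowed and the relation is the identity.\<close>

section \<open>Exchange functions and their distances\<close>

text \<open>In the application, \<open>D S\<close> says that \<open>sym_diff T S\<close> has a join;
  where there is none, \<open>nu\<close> is unspecified, hence the restriction of exchange and
  toggling to \<open>D\<close>.\<close>

locale exchange_function =
  fixes D :: "'v set \<Rightarrow> bool" and h :: "'v set \<Rightarrow> int" and E :: "'v \<Rightarrow> 'v \<Rightarrow> bool"
  assumes D_empty: "D {}"
    and h_empty: "h {} = 0"
    and exchange: "D S \<Longrightarrow> D S' \<Longrightarrow> i \<in> sym_diff S S' \<Longrightarrow>
      \<exists>j\<in>sym_diff S S'. j \<noteq> i \<and> h (sym_diff S {i, j}) + h (sym_diff S' {i, j}) \<le> h S + h S'"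
    and E_neq: "E x y \<Longrightarrow> x \<noteq> y"
    and E_sym: "E x y \<Longrightarrow> E y x"
    and D_toggle: "D S \<Longrightarrow> E x y \<Longrightarrow> D (sym_diff S {x, y})"
    and h_toggle: "D S \<Longrightarrow> E x y \<Longrightarrow> h (sym_diff S {x, y}) \<le> h S + 1"
    and h_edge: "E x y \<Longrightarrow> h {x, y} = - 1"
begin

text \<open>Toggling a vertex twice cancels, so the diagonal takes the value \<open>h {} = 0\<close>
  and not the value of \<open>h\<close> at a singleton.\<close>

definition dst :: "'v \<Rightarrow> 'v \<Rightarrow> int" where
  "dst x y = (if x = y then 0 else h {x, y})"

lemma dst_same [simp]: "dst x x = 0"
  by (simp add: dst_def)

lemma dst_commute: "dst x y = dst y x"
  by (simp add: dst_def insert_commute)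

lemma dst_edge: "E x y \<Longrightarrow> dst x y = - 1"
  using h_edge E_neq by (simp add: dst_def)

lemma conn_sym: "E\<^sup>*\<^sup>* x y \<Longrightarrow> E\<^sup>*\<^sup>* y x"
  by (metis E_sym sympI symp_rtranclp sympD)

lemma D_conn:
  assumes "E\<^sup>*\<^sup>* x y" "x \<noteq> y"
  shows "D {x, y}"
  using assms
proof (induction rule: rtranclp_induct)
  case (step y z)
  show ?case
  proof (cases "x = y")
    case True
    \<comment> \<open>The walk is back at \<open>x\<close>, where the induction hypothesis is
      silent; the last edge is toggled from the empty set instead.\<close>
    then show ?thesis using D_toggle[OF D_empty step.hyps(2)] by simp
  next
    case False
    have "sym_diff {x, y} {y, z} = {x, z}"
      using False step.prems E_neq[OF step.hyps(2)] by auto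
    then show ?thesis using D_toggle[OF step.IH[OF False] step.hyps(2)] by simp
  qed
qed simp

lemma dst_step_le:
  assumes "E\<^sup>*\<^sup>* x y" "E y z"
  shows "dst x z \<le> dst x y + 1"
proof (cases "x = y \<or> x = z")
  case True
  \<comment> \<open>For \<open>x = z\<close> the bound is tight: 0 against - 1 + 1.\<close>
  then show ?thesis
    using dst_edge[OF assms(2)] by (auto simp: dst_commute)
next
  case False
  have "sym_diff {x, y} {y, z} = {x, z}"
    using False E_neq[OF assms(2)] by auto
  then show ?thesis
    using h_toggle[OF D_conn[OF assms(1)] assms(2)] False by (simp add: dst_def)
qed

lemma dst_step_ge:
  assumes "E\<^sup>*\<^sup>* x y" "E y z"
  shows "dst x y \<le> dst x z + 1"
  using dst_step_le[OF rtranclp.rtrancl_into_rtrancl[OF assms] E_sym[OF assms(2)]] .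

text \<open>Exchange between \<open>{a, b}\<close> and \<open>{c, d}\<close> at \<open>a\<close>:
  the partner is \<open>b\<close>, \<open>d\<close> or \<open>c\<close>, in the order of the three
  alternatives.\<close>

lemma four_points:
  assumes "E\<^sup>*\<^sup>* a b" "E\<^sup>*\<^sup>* c d" "distinct [a, b, c, d]"
  shows "h {a, b, c, d} \<le> dst a b + dst c d \<or> dst a c + dst b d \<le> dst a b + dst c d
    \<or> dst a d + dst b c \<le> dst a b + dst c d"
proof -
  have "a \<in> sym_diff {a, b} {c, d}" using assms by auto
  moreover have "D {a, b}" "D {c, d}"
    using D_conn assms by auto
  ultimately obtain j where j: "j \<in> sym_diff {a, b} {c, d}" "j \<noteq> a"
    "h (sym_diff {a, b} {a, j}) + h (sym_diff {c, d} {a, j}) \<le> h {a, b} + h {c, d}"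
    using exchange[of "{a, b}" "{c, d}" a] by blast
  consider "j = b" | "j = c" | "j = d" using j by auto
  then show ?thesis
  proof cases
    case 1
    have "sym_diff {a, b} {a, b} = {}" "sym_diff {c, d} {a, b} = {a, b, c, d}"
      using assms by auto
    then show ?thesis using j(3) 1 assms by (simp add: dst_def h_empty)
  next
    case 2
    have "sym_diff {a, b} {a, c} = {b, c}" "sym_diff {c, d} {a, c} = {a, d}"
      using assms by auto
    then show ?thesis using j(3) 2 assms by (simp add: dst_def)
  next
    case 3
    have "sym_diff {a, b} {a, d} = {b, d}" "sym_diff {c, d} {a, d} = {a, c}"
      using assms by auto
    then show ?thesis using j(3) 3 assms by (simp add: dst_def)
  qed
qed

text \<open>Apply \<open>four_points\<close> to the pairs \<open>v x\<close> and \<open>w y\<close>.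
  The value at the four-element set is at least \<open>dst v w - 1\<close>, by toggling
  \<open>x y\<close>, and the pairing \<open>v w\<close>, \<open>x y\<close> has value exactly
  \<open>dst v w - 1\<close>; so two alternatives merge into one.\<close>

lemma four_points_edge:
  assumes "E\<^sup>*\<^sup>* v w" "E\<^sup>*\<^sup>* v x" "E x y" "distinct [v, w, x, y]"
  shows "dst v w - 1 \<le> dst v x + dst w y \<or> dst v y + dst w x \<le> dst v x + dst w y"
proof -
  have "sym_diff {v, x, w, y} {x, y} = {v, w}" "sym_diff {v, w} {x, y} = {v, x, w, y}"
    using assms(4) by auto
  then have "dst v w \<le> h {v, x, w, y} + 1"
    using h_toggle[of "{v, x, w, y}" x y] D_toggle[of "{v, w}" x y] D_conn[OF assms(1)] assms(3,4)
    by (simp add: dst_def)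
  moreover have "E\<^sup>*\<^sup>* w y"
    using conn_sym[OF assms(1)] assms(2,3) by simp
  then have "h {v, x, w, y} \<le> dst v x + dst w y \<or> dst v w + dst x y \<le> dst v x + dst w y
    \<or> dst v y + dst x w \<le> dst v x + dst w y"
    using four_points[of v x w y] assms by auto
  ultimately show ?thesis
    using dst_edge[OF assms(3)] dst_commute[of x w] by auto
qed

lemma four_points_edge':
  assumes "E\<^sup>*\<^sup>* v w" "E\<^sup>*\<^sup>* v x" "E x y" "distinct [v, w, x, y]"
  shows "dst v w - 1 \<le> dst v y + dst w x \<or> dst v x + dst w y \<le> dst v y + dst w x"
  using four_points_edge[of v w y x] assms E_sym[OF assms(3)] rtranclp.rtrancl_into_rtrancl[OF assms(2,3)]
  by auto

lemma walk_conn: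
  assumes "\<forall>i<k. E (p i) (p (Suc i))" "i \<le> j" "j \<le> k"
  shows "E\<^sup>*\<^sup>* (p i) (p j)"
  using assms(2,3)
proof (induction j rule: dec_induct)
  case (step n)
  then show ?case using assms(1) by (auto intro: rtranclp.rtrancl_into_rtrancl)
qed simp

text \<open>On a shortest walk with positive distance between its ends, the difference of the
  distances to the two ends would be constant at the inner vertices, although it is
  - 1 next to one end and 1 next to the other.\<close>

lemma walk_dst_nonpos:
  assumes "\<forall>i<k. E (p i) (p (Suc i))"
  shows "dst (p 0) (p k) \<le> 0"
  using assms
proof (induction k arbitrary: p rule: less_induct)
  case (less k)
  show ?case
  proof (rule ccontr)
    assume pos: "\<not> dst (p 0) (p k) \<le> 0"
    note conn = walk_conn[OF less.prems]
    have sub: "dst (p i) (p j) \<le> 0" if "i \<le> j" "j \<le> k" "j - i < k" for i j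
      using less.IH[of "j - i" "\<lambda>n. p (i + n)"] less.prems that by auto
    have "k \<noteq> 0" using pos by (metis dst_same order_refl)
    moreover have "k \<noteq> 1" using pos less.prems dst_edge[of "p 0" "p 1"] by auto
    ultimately have k: "2 \<le> k" by simp
    \<comment> \<open>A vertex repeating an end of the walk would give the same positive distance on
      a shorter stretch.\<close>
    have ne0: "p 0 \<noteq> p j" if "0 < j" "j \<le> k" for j
      using sub[of j k] that pos by auto
    have nek: "p j \<noteq> p k" if "j < k" for j
      using sub[of 0 j] that pos by auto
    have const: "dst (p 0) (p (Suc n)) - dst (p (Suc n)) (p k) = dst (p 0) (p 1) - dst (p 1) (p k)"
      if "Suc n < k" for n
      using that
    proof (induction n)
      case (Suc n)
      let ?x = "p (Suc n)" and ?y = "p (Suc (Suc n))"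
      have e: "E ?x ?y" using less.prems Suc.prems by simp
      have d: "distinct [p 0, p k, ?x, ?y]"
        using ne0[of k] ne0[of "Suc n"] ne0[of "Suc (Suc n)"] nek[of "Suc n"] nek[of "Suc (Suc n)"]
          E_neq[OF e] Suc.prems by auto
      have c: "E\<^sup>*\<^sup>* (p 0) (p k)" "E\<^sup>*\<^sup>* (p 0) ?x"
        using conn[of 0 k] conn[of 0 "Suc n"] Suc.prems by auto
      have "dst (p 0) ?x \<le> 0" "dst (p 0) ?y \<le> 0" "dst ?x (p k) \<le> 0" "dst ?y (p k) \<le> 0"
        using sub[of 0 "Suc n"] sub[of 0 "Suc (Suc n)"] sub[of "Suc n" k] sub[of "Suc (Suc n)" k]
          Suc.prems by auto
      \<comment> \<open>As \<open>dst (p 0) (p k)\<close> is at least 1, the first alternative of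
        either bound makes its right-hand side 0, the largest possible sum, so the second
        alternative holds in any case. The two second alternatives together give equality.\<close>
      then show ?case
        using four_points_edge[OF c e d] four_points_edge'[OF c e d] Suc pos
          dst_commute[of _ "p k"] by auto
    qed simp
    obtain m where m: "k = Suc (Suc m)" using k by (metis add_2_eq_Suc le_Suc_ex)
    have "E (p 0) (p 1)" "E (p (Suc m)) (p k)" using less.prems m by auto
    then have "dst (p 0) (p 1) = - 1" "dst (p (Suc m)) (p k) = - 1"
      using dst_edge by auto
    \<comment> \<open>Positivity between the ends makes the distance from each end to the neighbour
      of the other at least 0. The difference is then at most - 1 at \<open>p 1\<close> and at least
      1 at \<open>p (Suc m)\<close>.\<close>
    moreover have "dst (p 0) (p k) \<le> dst (p 0) (p (Suc m)) + 1"
      using dst_step_le conn[of 0 "Suc m"] \<open>E (p (Suc m)) (p k)\<close> m by simp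
    moreover have "dst (p k) (p 0) \<le> dst (p k) (p 1) + 1"
      using dst_step_le conn_sym conn[of 1 k] E_sym \<open>E (p 0) (p 1)\<close> m by simp
    moreover have "dst (p 1) (p k) \<le> 0" using sub[of 1 k] m by simp
    ultimately show False
      using const[of m] m pos dst_commute[of "p k"] by simp
  qed
qed

lemma conn_walk:
  assumes "E\<^sup>*\<^sup>* x y"
  obtains p k where "\<forall>i<k. E (p i) (p (Suc i))" "p 0 = x" "p k = y"
  using assms by (metis rtranclp_imp_relpowp relpowp_fun_conv)

lemma dst_nonpos: "E\<^sup>*\<^sup>* x y \<Longrightarrow> dst x y \<le> 0"
  by (metis conn_walk walk_dst_nonpos)

text \<open>For distinct vertices compare \<open>dst v x + dst w y\<close> with
  \<open>dst v y + dst w x\<close>, both nonpositive. If they differ, the four-point bounds force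
  the values - 1 and 0, so three of the four distances vanish, among them both from \<open>v\<close>
  or both from \<open>w\<close>.\<close>

lemma dst_diff_edge:
  assumes "dst v w = 0" "E\<^sup>*\<^sup>* v w" "E\<^sup>*\<^sup>* v x" "E x y"
  shows "dst w x - dst v x = dst w y - dst v y \<or> (dst v x = 0 \<and> dst v y = 0) \<or>
    (dst w x = 0 \<and> dst w y = 0)"
proof -
  have vy: "E\<^sup>*\<^sup>* v y" using assms by simp
  have wx: "E\<^sup>*\<^sup>* w x" using conn_sym[OF assms(2)] assms(3) by simp
  have wy: "E\<^sup>*\<^sup>* w y" using wx assms by simp
  note np = assms(3)[THEN dst_nonpos] vy[THEN dst_nonpos] wx[THEN dst_nonpos] wy[THEN dst_nonpos]
  note lip = dst_step_le[OF assms(3,4)] dst_step_ge[OF assms(3,4)]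
    dst_step_le[OF wx assms(4)] dst_step_ge[OF wx assms(4)]
  note comm = assms(1) dst_commute[of w v] dst_edge[OF assms(4)] dst_commute[of y x]
  consider "v = w" | "x = v" | "y = v" | "x = w" | "y = w" | "distinct [v, w, x, y]"
    using E_neq[OF assms(4)] by auto
  then show ?thesis
  proof cases
    case 6
    then show ?thesis
      using four_points_edge[OF assms(2-4) 6] four_points_edge'[OF assms(2-4) 6] np assms(1)
      by arith
  \<comment> \<open>When \<open>v\<close> or \<open>w\<close> is an end of the edge, the step bounds
    leave only 0 and - 1 for the one undetermined distance, and both fit.\<close>
  qed (use np lip comm in \<open>auto\<close>)
qed

text \<open>If both ends of the edge uw are at distance 0 from v, and x precedes u on a shortest walk
  from v to u, then the four vertices v, w, x, u force dst w x = - 2, whereas dst v x = - 1. By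
  \<open>dst_diff_edge\<close>, some earlier edge of the walk then has both ends at distance 0
  from v.\<close>

lemma walk_not_level:
  assumes "\<forall>i<n. E (p i) (p (Suc i))" "E (p n) w" "dst (p 0) (p n) = 0"
  shows "dst (p 0) w \<noteq> 0"
  using assms
proof (induction n arbitrary: w rule: less_induct)
  case (less n)
  note conn = walk_conn[OF less.prems(1)]
  show ?case
  proof
    assume w0: "dst (p 0) w = 0"
    let ?v = "p 0" and ?u = "p n"
    have uw: "dst ?u w = - 1" using dst_edge less.prems(2) .
    have "n \<noteq> 0" using uw w0 by (intro notI) simp
    then obtain m where m: "n = Suc m" by (cases n) auto
    let ?x = "p m"
    have xu: "E ?x ?u" using less.prems(1) m by simp
    \<comment> \<open>Induction hypothesis for the prefix ending in \<open>p i\<close>, followed by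
      the next edge of the walk.\<close>
    have level: "\<not> (dst ?v (p i) = 0 \<and> dst ?v (p (Suc i)) = 0)" if "i < n" for i
      using less.IH[OF that, of "p (Suc i)"] less.prems(1) that by auto
    have vx: "dst ?v ?x = - 1"
      using level[of m] less.prems(3) dst_step_le[OF conn[of 0 m] xu] dst_nonpos[OF conn[of 0 m]] m
      by auto
    have vw: "E\<^sup>*\<^sup>* ?v w"
      using conn[of 0 n] less.prems(2) by simp
    have ne: "distinct [?v, w, ?x, ?u]"
    proof -
      have "?v \<noteq> w" using w0 uw less.prems(3) by (auto simp: dst_commute)
      moreover have "?v \<noteq> ?x" using vx by auto
      moreover have "?v \<noteq> ?u" using w0 uw by auto
      moreover have "w \<noteq> ?x" using vx w0 by auto
      ultimately show ?thesis using E_neq[OF xu] E_neq[OF less.prems(2)] by auto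
    qed
    \<comment> \<open>The first alternative would read - 1 \<le> - 2, so the second one
      holds.\<close>
    have wx: "dst w ?x \<le> - 2"
      using four_points_edge[OF vw conn[of 0 m] xu ne] w0 less.prems(3) vx uw dst_commute[of w ?u] m
      by auto
    \<comment> \<open>Only an inequality survives: an edge at distance 0 from \<open>w\<close> may
      change the difference, but there \<open>dst ?v\<close> is still nonpositive.\<close>
    have "dst ?v (p i) \<le> dst w (p i)" if "i < n" for i
      using that
    proof (induction i)
      case 0
      then show ?case using w0 dst_commute[of w ?v] by simp
    next
      case (Suc i)
      have "E (p i) (p (Suc i))" using less.prems(1) Suc.prems by simp
      from dst_diff_edge[OF w0 vw conn[of 0 i] this] level[of i] Suc
        dst_nonpos[OF conn[of 0 "Suc i"]]
      show ?case by auto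
    qed
    from this[of m] wx vx m show False by auto
  qed
qed

lemma edge_not_level:
  assumes "E\<^sup>*\<^sup>* v x" "E x y" "dst v x = 0"
  shows "dst v y \<noteq> 0"
  using conn_walk[OF assms(1)] walk_not_level assms(2,3) by metis

text \<open>The difference is 0 at \<open>v\<close> itself, and \<open>edge_not_level\<close>, used
  from both \<open>v\<close> and \<open>w\<close>, excludes the exceptional alternatives of
  \<open>dst_diff_edge\<close> on every further edge.\<close>

lemma dst_eq_of_dst_zero:
  assumes "E\<^sup>*\<^sup>* v w" "dst v w = 0" "E\<^sup>*\<^sup>* v x"
  shows "dst w x = dst v x"
  using assms(3)
proof (induction rule: rtranclp_induct)
  case base
  then show ?case using assms(2) by (simp add: dst_commute)
next
  case (step x y)
  have "E\<^sup>*\<^sup>* w x" using conn_sym[OF assms(1)] step.hyps(1) by simp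
  then show ?case
    using dst_diff_edge[OF assms(2,1) step.hyps] edge_not_level step by force
qed

end

section \<open>Boundaries of edge sets modulo two\<close>

text \<open>The boundary map over the field with two elements; loops vanish because
  \<open>star\<close> omits them. Joins become edge sets with prescribed boundary.\<close>

definition boundary :: "('v, 'e) graph \<Rightarrow> 'e set \<Rightarrow> 'v set" where
  "boundary G F = {v. odd (card (star G v \<inter> F))}"

lemma finite_star: "finite_graph G \<Longrightarrow> finite (star G v)"
  by (auto simp: finite_graph_def star_def)

lemma star_outside: "finite_graph G \<Longrightarrow> v \<notin> verts G \<Longrightarrow> star G v = {}"
  by (fastforce simp: finite_graph_def star_def doubleton_eq_iff)

lemma join_iff_boundary:
  assumes "finite_graph G"
  shows "join G S F \<longleftrightarrow> F \<subseteq> edges G \<and> boundary G F = S"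
proof -
  have "even (card (star G v \<inter> F))" if "v \<notin> verts G" for v
    using star_outside[OF assms that] by simp
  then show ?thesis
    unfolding join_def boundary_def by blast
qed

lemma card_sym_diff:
  assumes "finite A" "finite B"
  shows "card (sym_diff A B) + 2 * card (A \<inter> B) = card A + card B"
proof -
  have "card (sym_diff A B) = card (A - B) + card (B - A)"
    using assms by (intro card_Un_disjoint) auto
  moreover have "card A = card (A - B) + card (A \<inter> B)" "card B = card (B - A) + card (A \<inter> B)"
    using assms card_Diff_subset_Int[of A B] card_Diff_subset_Int[of B A]
    by (simp_all add: Int_commute card_mono le_add_diff_inverse2)
  ultimately show ?thesis by simp
qed

lemma boundary_sym_diff:
  assumes "finite_graph G"
  shows "boundary G (sym_diff F F') = sym_diff (boundary G F) (boundary G F')"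
proof -
  have "even (card (star G v \<inter> sym_diff F F')) \<longleftrightarrow>
      even (card (star G v \<inter> F) + card (star G v \<inter> F'))" for v
  proof -
    have "star G v \<inter> sym_diff F F' = sym_diff (star G v \<inter> F) (star G v \<inter> F')" by blast
    then have "card (star G v \<inter> sym_diff F F') + 2 * card (star G v \<inter> F \<inter> (star G v \<inter> F'))
        = card (star G v \<inter> F) + card (star G v \<inter> F')"
      using card_sym_diff[of "star G v \<inter> F" "star G v \<inter> F'"] finite_star[OF assms] by simp
    then show ?thesis by (metis dvd_triv_left even_add)
  qed
  then show ?thesis by (auto simp: boundary_def)
qed

lemma join_sym_diff:
  assumes "finite_graph G" "join G S F" "P \<subseteq> edges G"
  shows "join G (sym_diff S (boundary G P)) (sym_diff F P)"
  using assms(2,3) unfolding join_iff_boundary[OF assms(1)] boundary_sym_diff[OF assms(1)] by auto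

lemma boundary_singleton:
  assumes "finite_graph G" "e \<in> edges G" "ends G e = {x, y}" "x \<noteq> y"
  shows "boundary G {e} = {x, y}"
proof -
  have "x \<in> verts G" "y \<in> verts G"
    using assms by (auto simp: finite_graph_def doubleton_eq_iff)
  then have "star G v \<inter> {e} = (if v \<in> {x, y} then {e} else {})" for v
    using assms by (auto simp: star_def doubleton_eq_iff)
  then show ?thesis by (auto simp: boundary_def)
qed

text \<open>Walk from \<open>i\<close>, deleting each edge used: deleting an edge \<open>i k\<close>
  moves the odd parity from \<open>i\<close> to \<open>k\<close>, unless \<open>k\<close> is odd
  already and the walk can stop. Later steps use only the boundary of \<open>P\<close>, so its shape
  as a path is not recorded.\<close>

lemma ex_path_in_boundary:
  assumes "finite_graph G" "H \<subseteq> edges G" "i \<in> boundary G H"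
  shows "\<exists>j P. j \<in> boundary G H \<and> j \<noteq> i \<and> P \<subseteq> H \<and> boundary G P = {i, j}"
  using assms(2,3)
proof (induction "card H" arbitrary: H i rule: less_induct)
  case less
  have fin: "finite H" using less.prems(1) assms(1) by (auto simp: finite_graph_def finite_subset)
  have "star G i \<inter> H \<noteq> {}"
    using less.prems(2) by (intro notI) (simp add: boundary_def)
  then obtain e k where e: "e \<in> H" "e \<in> edges G" "ends G e = {i, k}" "k \<noteq> i"
    by (auto simp: star_def)
  have be: "boundary G {e} = {i, k}"
    using boundary_singleton[OF assms(1) e(2,3)] e(4) by simp
  show ?case
  proof (cases "k \<in> boundary G H")
    case True
    then show ?thesis using be e by blast
  next
    case False
    have "H - {e} = sym_diff H {e}" using e by auto
    then have bH: "boundary G (H - {e}) = sym_diff (boundary G H) {i, k}"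
      using boundary_sym_diff[OF assms(1)] be by metis
    have "card (H - {e}) < card H" using fin e by (meson card_Diff1_less)
    from less.hyps[OF this, of k] obtain j P where P: "j \<in> boundary G (H - {e})" "j \<noteq> k"
      "P \<subseteq> H - {e}" "boundary G P = {k, j}"
      using less.prems bH False by auto
    \<comment> \<open>Deleting \<open>e\<close> makes \<open>i\<close> even, so the rest of the walk
      cannot end at \<open>i\<close>.\<close>
    have "j \<in> boundary G H" "j \<noteq> i" using P bH e less.prems by auto
    moreover have "boundary G (sym_diff P {e}) = sym_diff {k, j} {i, k}"
      using boundary_sym_diff[OF assms(1)] be P by metis
    moreover have "sym_diff {k, j} {i, k} = {i, j}" using P \<open>j \<noteq> i\<close> e by auto
    moreover have "sym_diff P {e} \<subseteq> H" using P e by auto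
    ultimately show ?thesis by metis
  qed
qed

section \<open>Sizes of minimum joins\<close>

lemma minimum_join_exists:
  assumes "join G S F"
  shows "\<exists>F'. minimum_join G S F'"
  using ex_has_least_nat[of "join G S" F card] assms by (auto simp: minimum_join_def)

lemma nu_eq_card: "minimum_join G S F \<Longrightarrow> nu G S = card F"
  unfolding nu_def by (rule the_equality) (auto simp: minimum_join_def intro: le_antisym)

lemma nu_le_card: "join G S F \<Longrightarrow> nu G S \<le> card F"
  by (metis minimum_join_exists nu_eq_card minimum_join_def)

lemma nu_attained: "join G S F \<Longrightarrow> \<exists>F'. join G S F' \<and> card F' = nu G S"
  by (metis minimum_join_exists nu_eq_card minimum_join_def)

text \<open>Each element of \<open>P\<close> lies in exactly one of the two sets and moves to the
  other.\<close>

lemma card_sym_diff_exchange: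
  assumes "finite A" "finite B" "P \<subseteq> sym_diff A B"
  shows "card (sym_diff A P) + card (sym_diff B P) = card A + card B"
proof -
  have "finite P" using assms by (meson finite_Diff finite_UnI finite_subset)
  moreover have "card P = card (A \<inter> P) + card (B \<inter> P)"
    using assms \<open>finite P\<close> by (subst card_Un_disjoint[symmetric]) (auto intro: arg_cong[of _ _ card])
  ultimately show ?thesis
    using card_sym_diff[of A P] card_sym_diff[of B P] assms by simp
qed

text \<open>Optimal joins for \<open>S\<close> and \<open>S'\<close> differ by an edge set with
  boundary \<open>sym_diff S S'\<close>; swapping a path from \<open>i\<close> inside it preserves
  their total size.\<close>

lemma nu_exchange:
  assumes "finite_graph G" "\<exists>F. join G S F" "\<exists>F. join G S' F" "i \<in> sym_diff S S'"
  shows "\<exists>j\<in>sym_diff S S'. j \<noteq> i \<and>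
    nu G (sym_diff S {i, j}) + nu G (sym_diff S' {i, j}) \<le> nu G S + nu G S'"
proof -
  obtain F F' where F: "join G S F" "card F = nu G S" "join G S' F'" "card F' = nu G S'"
    using assms nu_attained by metis
  have b: "F \<subseteq> edges G" "F' \<subseteq> edges G" "boundary G F = S" "boundary G F' = S'"
    using F join_iff_boundary[OF assms(1)] by auto
  have fin: "finite F" "finite F'"
    using b assms(1) by (auto simp: finite_graph_def finite_subset)
  have "boundary G (sym_diff F F') = sym_diff S S'"
    using boundary_sym_diff[OF assms(1)] b by metis
  moreover have H: "sym_diff F F' \<subseteq> edges G" using b by auto
  ultimately obtain j P where
    P: "j \<in> sym_diff S S'" "j \<noteq> i" "P \<subseteq> sym_diff F F'" "boundary G P = {i, j}"
    using ex_path_in_boundary[OF assms(1) H, of i] assms(4) by metis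
  have "P \<subseteq> edges G" using P(3) H by (rule order_trans)
  then have "join G (sym_diff S {i, j}) (sym_diff F P)" "join G (sym_diff S' {i, j}) (sym_diff F' P)"
    using join_sym_diff[OF assms(1) F(1)] join_sym_diff[OF assms(1) F(3)] P(4) by metis+
  then have "nu G (sym_diff S {i, j}) + nu G (sym_diff S' {i, j}) \<le> card F + card F'"
    using nu_le_card card_sym_diff_exchange[OF fin P(3)] by (metis add_mono)
  then show ?thesis using P F by auto
qed

lemma join_toggle:
  assumes "finite_graph G" "join G S F" "e \<in> edges G" "ends G e = {x, y}" "x \<noteq> y"
  shows "join G (sym_diff S {x, y}) (sym_diff F {e})"
  using join_sym_diff[OF assms(1,2), of "{e}"] assms(3) boundary_singleton[OF assms(1,3-5)] by simp

lemma nu_toggle: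
  assumes "finite_graph G" "join G S F" "e \<in> edges G" "ends G e = {x, y}" "x \<noteq> y"
  shows "nu G (sym_diff S {x, y}) \<le> nu G S + 1"
proof -
  obtain F' where F': "join G S F'" "card F' = nu G S" using nu_attained assms(2) by metis
  have "finite F'"
    using F' assms(1) by (auto simp: join_def finite_graph_def finite_subset)
  then have "card (sym_diff F' {e}) \<le> card F' + 1"
    using card_sym_diff[of F' "{e}"] by simp
  then show ?thesis
    using nu_le_card[OF join_toggle[OF assms(1) F'(1) assms(3-5)]] F'(2) by simp
qed

text \<open>Deleting the edge from a minimum join saves one; toggling it back shows that no more can
  be saved.\<close>

lemma nu_allowed:
  assumes "finite_graph G" "allowed G T e" "ends G e = {x, y}" "x \<noteq> y"
  shows "nu G (sym_diff T {x, y}) + 1 = nu G T"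
proof -
  obtain F where F: "minimum_join G T F" "e \<in> F" "e \<in> edges G"
    using assms(2) by (auto simp: allowed_def)
  have j: "join G T F" using F by (simp add: minimum_join_def)
  have fin: "finite F"
    using j assms(1) by (auto simp: join_def finite_graph_def finite_subset)
  note t = join_toggle[OF assms(1) j F(3) assms(3,4)]
  have "card (sym_diff F {e}) + 1 = card F"
    using card_sym_diff[of F "{e}"] fin F(2) by (simp add: Int_insert_right)
  then have "nu G (sym_diff T {x, y}) + 1 \<le> nu G T"
    using nu_le_card[OF t] nu_eq_card[OF F(1)] by simp
  moreover have "sym_diff (sym_diff T {x, y}) {x, y} = T" by auto
  then have "nu G T \<le> nu G (sym_diff T {x, y}) + 1"
    using nu_toggle[OF assms(1) t F(3) assms(3,4)] by simp
  ultimately show ?thesis by simp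
qed

text \<open>Loops are left out: they have empty boundary, so toggling one does not change the
  terminal set.\<close>

definition allowed_adj :: "('v, 'e) graph \<Rightarrow> 'v set \<Rightarrow> 'v \<Rightarrow> 'v \<Rightarrow> bool" where
  "allowed_adj G T x y \<longleftrightarrow> x \<noteq> y \<and> (\<exists>e. allowed G T e \<and> ends G e = {x, y})"

lemma exchange_function_nu:
  assumes "finite_graph G" "join G T F"
  shows "exchange_function (\<lambda>S. \<exists>F. join G (sym_diff T S) F)
    (\<lambda>S. int (nu G (sym_diff T S)) - int (nu G T)) (allowed_adj G T)"
proof -
  \<comment> \<open>The shift by \<open>T\<close> commutes with toggling and leaves symmetric
    differences unchanged, so the facts on \<open>nu\<close> carry over.\<close>
  have assoc: "sym_diff T (sym_diff A B) = sym_diff (sym_diff T A) B" for A B :: "'a set" by auto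
  have cancel: "sym_diff (sym_diff T A) (sym_diff T B) = sym_diff A B" for A B by auto
  show ?thesis
  proof
    fix S S' i
    assume "\<exists>F. join G (sym_diff T S) F" "\<exists>F. join G (sym_diff T S') F" "i \<in> sym_diff S S'"
    then show "\<exists>j\<in>sym_diff S S'. j \<noteq> i \<and>
      int (nu G (sym_diff T (sym_diff S {i, j}))) - int (nu G T) +
      (int (nu G (sym_diff T (sym_diff S' {i, j}))) - int (nu G T))
      \<le> int (nu G (sym_diff T S)) - int (nu G T) + (int (nu G (sym_diff T S')) - int (nu G T))"
      using nu_exchange[OF assms(1), of "sym_diff T S" "sym_diff T S'" i]
      unfolding cancel assoc by fastforce
  next
    fix S x y
    assume a: "\<exists>F. join G (sym_diff T S) F" "allowed_adj G T x y"
    then obtain F e where e: "join G (sym_diff T S) F" "e \<in> edges G" "ends G e = {x, y}" "x \<noteq> y"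
      by (auto simp: allowed_adj_def allowed_def)
    show "\<exists>F. join G (sym_diff T (sym_diff S {x, y})) F"
      using join_toggle[OF assms(1) e] unfolding assoc by blast
    show "int (nu G (sym_diff T (sym_diff S {x, y}))) - int (nu G T)
      \<le> int (nu G (sym_diff T S)) - int (nu G T) + 1"
      using nu_toggle[OF assms(1) e] unfolding assoc by simp
  next
    fix x y
    assume "allowed_adj G T x y"
    then show "int (nu G (sym_diff T {x, y})) - int (nu G T) = - 1"
      using nu_allowed[OF assms(1)] by (fastforce simp: allowed_adj_def)
  qed (use assms in \<open>auto simp: allowed_adj_def insert_commute\<close>)
qed

section \<open>Simple paths and factor-connectedness\<close>

text \<open>The vertex and edge sets are carried along because the path must finally be exhibited as
  a graph with known degrees.\<close>

inductive simple_path :: "('v, 'e) graph \<Rightarrow> 'e set \<Rightarrow> 'v \<Rightarrow> 'v set \<Rightarrow> 'e set \<Rightarrow> 'v \<Rightarrow> bool"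
  for G A u where
  single: "u \<in> verts G \<Longrightarrow> simple_path G A u {u} {} u"
| extend: "simple_path G A u V B y \<Longrightarrow> e \<in> A \<Longrightarrow> ends G e = {y, z} \<Longrightarrow> z \<in> verts G \<Longrightarrow>
    z \<notin> V \<Longrightarrow> simple_path G A u (insert z V) (insert e B) z"

text \<open>Cuts the path back when a walk returns to a visited vertex.\<close>

lemma simple_path_prefix:
  assumes "simple_path G A u V B y" "x \<in> V"
  shows "\<exists>V' B'. simple_path G A u V' B' x"
  using assms
proof (induction)
  case (extend V B y e z)
  then show ?case using simple_path.extend[OF extend.hyps] by (cases "x = z") blast+
qed (blast intro: simple_path.single)

lemma simple_path_verts:
  assumes "simple_path G A u V B y"
  shows "finite V" "finite B" "V \<subseteq> verts G" "B \<subseteq> A" "u \<in> V" "y \<in> V"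
  using assms by (induction) simp_all

lemma simple_path_ends:
  assumes "simple_path G A u V B y" "e \<in> B"
  shows "\<exists>a\<in>V. \<exists>b\<in>V. a \<noteq> b \<and> ends G e = {a, b}"
  using assms
proof (induction)
  case (extend V B y e' z)
  show ?case
  proof (cases "e = e'")
    case True
    then show ?thesis
      using extend.hyps simple_path_verts(6)[OF extend.hyps(1)]
      by (intro bexI[of _ y] bexI[of _ z]) auto
  next
    case False
    then show ?thesis using extend.IH extend.prems by blast
  qed
qed simp

lemma simple_path_conn:
  assumes "simple_path G A u V B y" "x \<in> V"
  shows "(u, x) \<in> (adj_rel \<lparr>verts = V, edges = B, ends = ends G\<rparr>)\<^sup>*"
  using assms
proof (induction arbitrary: x)
  case (extend V B y e z)
  let ?R = "adj_rel \<lparr>verts = V, edges = B, ends = ends G\<rparr>"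
  let ?R' = "adj_rel \<lparr>verts = insert z V, edges = insert e B, ends = ends G\<rparr>"
  have mono: "?R\<^sup>* \<subseteq> ?R'\<^sup>*" by (rule rtrancl_mono) (auto simp: adj_rel_def)
  have y: "(u, y) \<in> ?R'\<^sup>*"
    using extend.IH[OF simple_path_verts(6)[OF extend.hyps(1)]] mono by blast
  have "(y, z) \<in> ?R'" using extend.hyps by (auto simp: adj_rel_def)
  then show ?case
    using rtrancl.rtrancl_into_rtrancl[OF y] extend.IH[of x] extend.prems mono by blast
qed simp

text \<open>Each end role replaces one missing edge; in this form the single vertex, with both
  roles, is no exception. Appending an edge passes the role from \<open>y\<close> to
  \<open>z\<close>.\<close>

lemma simple_path_degree:
  assumes "simple_path G A u V B y" "x \<in> V"
  shows "card {e \<in> B. x \<in> ends G e} + of_bool (x = u) + of_bool (x = y) = 2"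
  using assms
proof (induction arbitrary: x)
  case (extend V B y e z)
  note inv = simple_path_verts[OF extend.hyps(1)]
  have sub: "ends G e' \<subseteq> V" if "e' \<in> B" for e'
    using simple_path_ends[OF extend.hyps(1) that] by auto
  have "e \<notin> B" using sub[of e] extend.hyps by auto
  have fin: "finite {e \<in> B. x \<in> ends G e}" using inv by simp
  have "{e' \<in> insert e B. x \<in> ends G e'} =
      (if x \<in> {y, z} then insert e {e \<in> B. x \<in> ends G e} else {e \<in> B. x \<in> ends G e})"
    using extend.hyps by auto
  then have c: "card {e' \<in> insert e B. x \<in> ends G e'} =
      card {e \<in> B. x \<in> ends G e} + of_bool (x \<in> {y, z})"
    using fin \<open>e \<notin> B\<close> by simp
  show ?case
  proof (cases "x = z")
    case True
    then have "{e \<in> B. x \<in> ends G e} = {}" using sub extend.hyps by auto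
    then have "card {e \<in> B. x \<in> ends G e} = 0" by (metis card.empty)
    then show ?thesis using c True inv extend.hyps by auto
  next
    case False
    then show ?thesis using c extend.IH[of x] extend.prems inv extend.hyps(5) by auto
  qed
qed simp

lemma adj_rel_sym: "sym (adj_rel G)"
  by (auto simp: sym_def adj_rel_def insert_commute)

lemma simple_path_path_between:
  assumes "simple_path G A u V B y"
  shows "path_between \<lparr>verts = V, edges = B, ends = ends G\<rparr> u y"
proof -
  let ?P = "\<lparr>verts = V, edges = B, ends = ends G\<rparr>"
  note inv = simple_path_verts[OF assms]
  \<comment> \<open>Makes the loop term of \<open>degree\<close> vanish.\<close>
  have "{e \<in> B. ends G e = {x}} = {}" for x
    using simple_path_ends[OF assms] by fastforce
  then have loops: "card {e \<in> B. ends G e = {x}} = 0" for x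
    by (metis card.empty)
  have deg: "degree ?P x + of_bool (x = u) + of_bool (x = y) = 2" if "x \<in> V" for x
    unfolding degree_def using simple_path_degree[OF assms that] loops[of x] by simp
  have "degree ?P x \<le> 2 \<and> (degree ?P x < 2 \<longleftrightarrow> x \<in> {u, y})" if "x \<in> V" for x
    using deg[OF that] by (auto simp: of_bool_def split: if_splits)
  moreover have "finite_graph ?P"
    using inv simple_path_ends[OF assms] by (fastforce simp: finite_graph_def)
  moreover have "(a, b) \<in> (adj_rel ?P)\<^sup>*" if "a \<in> V" "b \<in> V" for a b
    using simple_path_conn[OF assms that(1)] simple_path_conn[OF assms that(2)]
      sym_rtrancl[OF adj_rel_sym[of ?P]] by (meson rtrancl_trans symD)
  then have "connected_graph ?P"
    using inv by (auto simp: connected_graph_def)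
  ultimately show ?thesis
    using inv unfolding path_between_def is_path_def by auto
qed

lemma factor_connected_iff:
  assumes "finite_graph G" "u \<in> verts G"
  shows "factor_connected G T u v \<longleftrightarrow> (allowed_adj G T)\<^sup>*\<^sup>* u v"
proof
  assume "factor_connected G T u v"
  then obtain P where P: "subgraph P G" "path_between P u v" "\<forall>e\<in>edges P. allowed G T e"
    by (auto simp: factor_connected_def)
  have "(u, v) \<in> (adj_rel P)\<^sup>*"
    using P(2) by (auto simp: path_between_def is_path_def connected_graph_def)
  then show "(allowed_adj G T)\<^sup>*\<^sup>* u v"
  proof (induction rule: rtrancl_induct)
    case (step y z)
    \<comment> \<open>A loop of \<open>P\<close> relates a vertex to itself.\<close>
    then have "y = z \<or> allowed_adj G T y z"
      using P by (fastforce simp: adj_rel_def allowed_adj_def subgraph_def)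
    then show ?case using step by auto
  qed simp
next
  assume "(allowed_adj G T)\<^sup>*\<^sup>* u v"
  then have "\<exists>V B. simple_path G {e. allowed G T e} u V B v"
  proof (induction rule: rtranclp_induct)
    case base
    then show ?case using simple_path.single assms(2) by metis
  next
    case (step y z)
    obtain e where e: "allowed G T e" "ends G e = {y, z}"
      using step.hyps by (auto simp: allowed_adj_def)
    have "z \<in> verts G"
      using e assms(1) by (fastforce simp: finite_graph_def allowed_def doubleton_eq_iff)
    \<comment> \<open>If \<open>z\<close> was visited, the path is cut back to \<open>z\<close>;
      otherwise the edge is appended.\<close>
    then show ?case
      using step.IH e simple_path_prefix simple_path.extend by (metis mem_Collect_eq)
  qed
  then obtain V B where p: "simple_path G {e. allowed G T e} u V B v" by blast
  note inv = simple_path_verts[OF p]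
  have "subgraph \<lparr>verts = V, edges = B, ends = ends G\<rparr> G"
    using simple_path_path_between[OF p] inv
    by (auto simp: subgraph_def path_between_def is_path_def allowed_def)
  then show "factor_connected G T u v"
    using simple_path_path_between[OF p] inv unfolding factor_connected_def
    by (intro exI[of _ "\<lparr>verts = V, edges = B, ends = ends G\<rparr>"]) auto
qed

section \<open>Equivalence of the relation on a graft\<close>

theorem theorem6p6:
  fixes G :: "('v, 'e) graph" and T :: "'v set"
  assumes "graft G T"
  shows "equiv (verts G) (graft_rel G T)"
proof -
  have fin: "finite_graph G" using assms by (simp add: graft_def)
  have "trans (graft_rel G T)"
  proof (cases "\<exists>F. join G T F")
    case False
    then have "\<not> allowed_adj G T x y" for x y
      by (auto simp: allowed_adj_def allowed_def minimum_join_def)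
    then have "(allowed_adj G T)\<^sup>*\<^sup>* u v \<Longrightarrow> u = v" for u v
      by (metis rtranclp.cases)
    then show ?thesis
      using factor_connected_iff[OF fin] by (fastforce simp: trans_def graft_rel_def)
  next
    case True
    then interpret nu: exchange_function "\<lambda>S. \<exists>F. join G (sym_diff T S) F"
      "\<lambda>S. int (nu G (sym_diff T S)) - int (nu G T)" "allowed_adj G T"
      using exchange_function_nu[OF fin] by blast
    \<comment> \<open>The diagonal value of \<open>dst\<close> absorbs the case
      \<open>u = v\<close>.\<close>
    have rel: "(u, v) \<in> graft_rel G T \<longleftrightarrow> u \<in> verts G \<and> v \<in> verts G \<and>
        (allowed_adj G T)\<^sup>*\<^sup>* u v \<and> nu.dst u v = 0" for u v
      using factor_connected_iff[OF fin] by (auto simp: graft_rel_def nu.dst_def)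
    show ?thesis
    proof (rule transI)
      fix u v w
      assume "(u, v) \<in> graft_rel G T" "(v, w) \<in> graft_rel G T"
      \<comment> \<open>Seen from the middle vertex: \<open>dst v u = 0\<close> gives
        \<open>dst u w = dst v w = 0\<close>.\<close>
      then show "(u, w) \<in> graft_rel G T"
        using nu.dst_eq_of_dst_zero[of v u w] nu.conn_sym nu.dst_commute
        unfolding rel by (metis rtranclp_trans)
    qed
  qed
  moreover have "sym (graft_rel G T)"
    by (auto simp: sym_def graft_rel_def factor_connected_def path_between_def insert_commute)
  ultimately show ?thesis
    by (auto simp: equiv_def refl_on_def graft_rel_def)
qed

end
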